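(* Let $(S,\leq)$ be an Artinian strictly totally ordered monoid, let $R$ be a ring, and let $\omega:S\to\mathrm{End}(R)$, $s\mapsto\omega_s$, be a monoid homomorphism. Suppose that $R$ is right archimedean and $S$-rigid (with respect to $\omega$), that $R$ satisfies the ascending chain condition on annihilators, and that $\omega_s$ preserves nonunits of $R$ for each $s\in S$ (that is, $\omega_s(r)$ is a nonunit whenever $r\in R$ is a nonunit). Then the skew generalized power series ring $R[[S,\omega]]$ is a right archimedean reduced ring.
   Context: Rings and monoids have an identity element, preserved by homomorphisms, and are not assumed commutative. $\mathrm{End}(R)$ is the monoid of (unital) ring endomorphisms of $R$. A ring is reduced if it has no nonzero nilpotent elements. A ring $R$ is left archimedean if $\bigcap_{n\in\mathbb{N}} Rr^n=\{0\}$ for each nonunit $r\in R$, and right archimedean if $\bigcap_{n\in\mathbb{N}} r^nR=\{0\}$ for each nonunit $r\in R$. An endomorphism $\alpha$ of $R$ is rigid if for $a\in R$, $a\alpha(a)=0$ implies $a=0$. The ring $R$ is $S$-rigid (with respect to $\omega$) if $\omega_s$ is a rigid endomorphism of $R$ for every $s\in S$. The ascending chain condition on annihilators refers to annihilators in $R$ of subsets of $R$; since an $S$-rigid ring is reduced, left and right annihilators of a subset coincide. A partially ordered set is Artinian if every strictly decreasing sequence of its elements is finite, and narrow if every subset of pairwise order-incomparable elements is finite. An ordered monoid is a monoid $S$ with a partial order $\leq$ such that $a\leq b$ implies $ca\leq cb$ and $ac\leq bc$ for all $a,b,c\in S$; it is strictly ordered if $a<b$ implies $ca<cb$ and $ac<bc$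 for all $a,b,c\in S$; it is strictly totally ordered if moreover $\leq$ is a total order; and an Artinian one is one whose underlying ordered set is Artinian. For a strictly ordered monoid $(S,\leq)$ and a monoid homomorphism $\omega:S\to\mathrm{End}(R)$, the skew generalized power series ring $R[[S,\omega]]$ is the set of all functions $f:S\to R$ whose support $\mathrm{supp}(f)=\{s\in S: f(s)\neq 0\}$ is Artinian and narrow, with pointwise addition and multiplication $(fg)(s)=\sum_{(u,v)\in X_s(f,g)} f(u)\,\omega_u(g(v))$, where $X_s(f,g)=\{(u,v)\in \mathrm{supp}(f)\times\mathrm{supp}(g): s=uv\}$, which is a finite set (an empty sum is $0$). *)

theory Defs
  imports "HOL-Algebra.Algebra"
begin

section \<open>Rings\<close>

definition reduced :: "('a, 'm) ring_scheme \<Rightarrow> bool" where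
  "reduced R \<longleftrightarrow>
     (\<forall>a\<in>carrier R. (\<exists>n::nat. a [^]\<^bsub>R\<^esub> n = \<zero>\<^bsub>R\<^esub>) \<longrightarrow> a = \<zero>\<^bsub>R\<^esub>)"

definition right_archimedean :: "('a, 'm) ring_scheme \<Rightarrow> bool" where
  "right_archimedean R \<longleftrightarrow>
     (\<forall>r\<in>carrier R - Units R.
        (\<Inter>n::nat. (r [^]\<^bsub>R\<^esub> n) <#\<^bsub>R\<^esub> carrier R) = {\<zero>\<^bsub>R\<^esub>})"

definition right_annihilator :: "('a, 'm) ring_scheme \<Rightarrow> 'a set \<Rightarrow> 'a set" where
  "right_annihilator R A = {a \<in> carrier R. \<forall>x\<in>A. x \<otimes>\<^bsub>R\<^esub> a = \<zero>\<^bsub>R\<^esub>}"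

text \<open>The condition is phrased with right annihilators. In a reduced ring the left and
  the right annihilator of a subset coincide, so there it does not depend on the side.\<close>

definition acc_on_annihilators :: "('a, 'm) ring_scheme \<Rightarrow> bool" where
  "acc_on_annihilators R \<longleftrightarrow>
     (\<forall>C :: nat \<Rightarrow> 'a set.
        (\<forall>n. \<exists>A. A \<subseteq> carrier R \<and> C n = right_annihilator R A) \<and> (\<forall>n. C n \<subseteq> C (Suc n))
        \<longrightarrow> (\<exists>N. \<forall>n\<ge>N. C n = C N))"

definition preserves_nonunits :: "('a, 'm) ring_scheme \<Rightarrow> ('a \<Rightarrow> 'a) \<Rightarrow> bool" where
  "preserves_nonunits R \<alpha> \<longleftrightarrow> (\<forall>r\<in>carrier R - Units R. \<alpha> r \<in> carrier R - Units R)"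

text \<open>As in \<^const>\<open>BijGroup\<close>, endomorphisms are extensional functions: without this the
  carrier would contain several copies of each endomorphism, differing outside
  \<^term>\<open>carrier R\<close>. Products are compositions: the product of \<open>\<alpha>\<close> and \<open>\<beta>\<close> applies \<open>\<beta>\<close> first.\<close>

definition End_monoid :: "('a, 'm) ring_scheme \<Rightarrow> ('a \<Rightarrow> 'a) monoid" where
  "End_monoid R =
     \<lparr>carrier = ring_hom R R \<inter> extensional (carrier R),
      monoid.mult = compose (carrier R),
      monoid.one = (\<lambda>a\<in>carrier R. a)\<rparr>"

definition rigid_endomorphism :: "('a, 'm) ring_scheme \<Rightarrow> ('a \<Rightarrow> 'a) \<Rightarrow> bool" where
  "rigid_endomorphism R \<alpha> \<longleftrightarrow> \<alpha> \<in> ring_hom R R \<and>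
     (\<forall>a\<in>carrier R. a \<otimes>\<^bsub>R\<^esub> \<alpha> a = \<zero>\<^bsub>R\<^esub> \<longrightarrow> a = \<zero>\<^bsub>R\<^esub>)"

definition S_rigid ::
  "('s, 'n) monoid_scheme \<Rightarrow> ('a, 'm) ring_scheme \<Rightarrow> ('s \<Rightarrow> 'a \<Rightarrow> 'a) \<Rightarrow> bool" where
  "S_rigid S R \<omega> \<longleftrightarrow> (\<forall>s\<in>carrier S. rigid_endomorphism R (\<omega> s))"

section \<open>Ordered monoids\<close>

text \<open>Orders are relations: \<^term>\<open>(a, b) \<in> leq\<close> means that \<open>a\<close> is at most \<open>b\<close>, and
  \<^term>\<open>leq - Id\<close> is the strict part.\<close>

definition artinian_on :: "'s set \<Rightarrow> 's rel \<Rightarrow> bool" where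
  "artinian_on A leq \<longleftrightarrow>
     \<not> (\<exists>x :: nat \<Rightarrow> 's. (\<forall>i. x i \<in> A) \<and> (\<forall>i. (x (Suc i), x i) \<in> leq - Id))"

definition narrow_on :: "'s set \<Rightarrow> 's rel \<Rightarrow> bool" where
  "narrow_on A leq \<longleftrightarrow>
     (\<forall>B\<subseteq>A. (\<forall>a\<in>B. \<forall>b\<in>B. a \<noteq> b \<longrightarrow> (a, b) \<notin> leq \<and> (b, a) \<notin> leq) \<longrightarrow> finite B)"

text \<open>Homomorphisms of monoids preserve the identity element; this does not follow from
  membership in \<^const>\<open>hom\<close>.\<close>

definition monoid_homomorphism ::
  "('s, 'n) monoid_scheme \<Rightarrow> ('t, 'k) monoid_scheme \<Rightarrow> ('s \<Rightarrow> 't) \<Rightarrow> bool" where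
  "monoid_homomorphism S T h \<longleftrightarrow> h \<in> hom S T \<and> h \<one>\<^bsub>S\<^esub> = \<one>\<^bsub>T\<^esub>"

locale ordered_monoid = monoid S for S (structure) +
  fixes leq :: "'a rel"
  assumes order: "partial_order_on (carrier S) leq"
    and mult_mono:
      "\<lbrakk>a \<in> carrier S; b \<in> carrier S; c \<in> carrier S; (a, b) \<in> leq\<rbrakk>
        \<Longrightarrow> (c \<otimes> a, c \<otimes> b) \<in> leq \<and> (a \<otimes> c, b \<otimes> c) \<in> leq"

locale strictly_ordered_monoid = ordered_monoid +
  assumes mult_strict_mono:
      "\<lbrakk>a \<in> carrier S; b \<in> carrier S; c \<in> carrier S; (a, b) \<in> leq - Id\<rbrakk>
        \<Longrightarrow> (c \<otimes> a, c \<otimes> b) \<in> leq - Id \<and> (a \<otimes> c, b \<otimes> c) \<in> leq - Id"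

locale strictly_totally_ordered_monoid = strictly_ordered_monoid +
  assumes total: "total_on (carrier S) leq"

section \<open>Skew generalized power series\<close>

definition supp ::
  "('s, 'n) monoid_scheme \<Rightarrow> ('a, 'm) ring_scheme \<Rightarrow> ('s \<Rightarrow> 'a) \<Rightarrow> 's set" where
  "supp S R f = {s \<in> carrier S. f s \<noteq> \<zero>\<^bsub>R\<^esub>}"

definition factor_pairs ::
  "('s, 'n) monoid_scheme \<Rightarrow> ('a, 'm) ring_scheme \<Rightarrow> 's \<Rightarrow> ('s \<Rightarrow> 'a) \<Rightarrow> ('s \<Rightarrow> 'a) \<Rightarrow> ('s \<times> 's) set"
  where
  "factor_pairs S R s f g = {(u, v) \<in> supp S R f \<times> supp S R g. s = u \<otimes>\<^bsub>S\<^esub> v}"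

text \<open>Functions on \<^term>\<open>carrier S\<close> are represented by extensional functions, so that
  equality in the carrier is equality of series.\<close>

definition skew_gps_ring ::
  "('s, 'n) monoid_scheme \<Rightarrow> 's rel \<Rightarrow> ('a, 'm) ring_scheme \<Rightarrow> ('s \<Rightarrow> 'a \<Rightarrow> 'a) \<Rightarrow> ('s \<Rightarrow> 'a) ring"
  where
  "skew_gps_ring S leq R \<omega> =
     \<lparr>carrier = {f \<in> carrier S \<rightarrow>\<^sub>E carrier R.
                   artinian_on (supp S R f) leq \<and> narrow_on (supp S R f) leq},
      monoid.mult = (\<lambda>f g. \<lambda>s\<in>carrier S.
                \<Oplus>\<^bsub>R\<^esub>p\<in>factor_pairs S R s f g. f (fst p) \<otimes>\<^bsub>R\<^esub> \<omega> (fst p) (g (snd p))),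
      monoid.one = (\<lambda>s\<in>carrier S. if s = \<one>\<^bsub>S\<^esub> then \<one>\<^bsub>R\<^esub> else \<zero>\<^bsub>R\<^esub>),
      ring.zero = (\<lambda>s\<in>carrier S. \<zero>\<^bsub>R\<^esub>),
      ring.add = (\<lambda>f g. \<lambda>s\<in>carrier S. f s \<oplus>\<^bsub>R\<^esub> g s)\<rparr>"

end

theory Submission
  imports Defs
begin

text \<open>Write \<open>A\<close> for the series ring. An artinian strictly totally ordered monoid \<open>S\<close> is
  well-ordered with least element \<open>\<one>\<close>, so every function from \<open>S\<close> to \<open>R\<close> is a series, each
  element of \<open>S\<close> has finitely many factorizations, and a series is a unit as soon as its
  coefficient at \<open>\<one>\<close> is a unit (\<open>unit_if_unit_at_one\<close>).

  The ring \<open>R\<close> may have zero divisors, so leading coefficients need not multiply to leading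
  coefficients. This is repaired by working modulo an ideal \<open>P\<close>. Rigidity makes \<open>R\<close>
  reduced, and in a reduced ring with the chain condition every \<open>x \<noteq> 0\<close> avoids some annihilator
  \<open>P\<close> of a single element \<open>c\<close> such that \<open>R / P\<close> has no zero divisors
  (\<open>completely_prime_annihilator_exists\<close>). Rigidity also gives \<open>\<omega>\<^sub>s(a) \<in> P\<close> if and only if \<open>a \<in> P\<close>
  (\<open>rigid_in_annihilator_iff\<close>), so \<open>\<omega>\<close> acts on \<open>R / P\<close> by injective endomorphisms, and modulo \<open>P\<close>
  the positions of leading terms of series multiply (\<open>leads_mult\<close>).

  Reducedness follows at once: if \<open>f\<close> has a nonzero coefficient, choose \<open>P\<close> avoiding it; then \<open>f\<close>
  has a leading term modulo \<open>P\<close>, hence so do all its powers.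

  Now let \<open>f\<close> be a nonunit and let \<open>g \<noteq> 0\<close> lie in \<open>f\<^sup>nA\<close> for all \<open>n\<close>. Choose \<open>P\<close>, the
  annihilator of \<open>c\<close>, avoiding a coefficient of \<open>g\<close>. If \<open>f\<close> led at some \<open>t \<noteq> \<one>\<close> modulo \<open>P\<close>,
  then the leading position of \<open>g\<close> would be divisible by all powers of \<open>t\<close>, which gives an infinite
  descent in \<open>S\<close>. So \<open>f\<close> leads at \<open>\<one>\<close>, and the leading coefficient \<open>b\<close> of \<open>g\<close> lies in
  \<open>f(\<one>)\<^sup>nR + P\<close> for all \<open>n\<close> (\<open>leading_coeff_divisible\<close>). Therefore \<open>b c\<close> lies in every
  \<open>f(\<one>)\<^sup>nR\<close>. As \<open>f(\<one>)\<close> is a nonunit of the right archimedean ring \<open>R\<close>, this forces \<open>b c = 0\<close>,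
  that is, \<open>b \<in> P\<close>, a contradiction.\<close>

section \<open>Well-ordered monoids\<close>

text \<open>The elements below a given one are finite in number by induction along \<open>r\<close>, because
  well-foundedness of the converse provides a greatest one among them.\<close>

lemma finite_if_wf_and_converse_wf:
  assumes tot: "total_on A r" and wf: "wf r" and wf': "wf (r\<inverse>)"
  shows "finite A"
proof -
  \<comment> \<open>A set below which everything is finite is finite: split it at its greatest element.\<close>
  have step: "finite L" if "L \<subseteq> A" and below: "\<And>m. m \<in> L \<Longrightarrow> finite {b \<in> A. (b, m) \<in> r}" for L
  proof (cases "L = {}")
    case False
    then obtain m where m: "m \<in> L" "\<And>y. (m, y) \<in> r \<Longrightarrow> y \<notin> L"
      using wf' by (metis all_not_in_conv converse_iff wf_eq_minimal)
    have "L \<subseteq> insert m {b \<in> A. (b, m) \<in> r}"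
      using m tot \<open>L \<subseteq> A\<close> unfolding total_on_def by blast
    then show ?thesis
      using below[OF m(1)] by (meson finite.insertI finite_subset)
  qed simp
  have "finite {b \<in> A. (b, a) \<in> r}" for a
    using wf by (induction a) (rule step; blast)
  then show ?thesis
    using step by blast
qed

locale well_ordered_monoid = strictly_totally_ordered_monoid S leq
  for S (structure) and leq +
  assumes artinian: "artinian_on (carrier S) leq"
begin

abbreviation less :: "'a rel" where "less \<equiv> leq - Id"

lemma leq_subset: "leq \<subseteq> carrier S \<times> carrier S"
  and leq_refl: "a \<in> carrier S \<Longrightarrow> (a, a) \<in> leq"
  and leq_trans: "\<lbrakk>(a, b) \<in> leq; (b, c) \<in> leq\<rbrakk> \<Longrightarrow> (a, c) \<in> leq"
  and leq_antisym: "\<lbrakk>(a, b) \<in> leq; (b, a) \<in> leq\<rbrakk> \<Longrightarrow> a = b"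
  using order unfolding partial_order_on_def preorder_on_def refl_on_def trans_def antisym_def
  by blast+

lemma leq_carrier:
  assumes "(a, b) \<in> leq"
  shows "a \<in> carrier S" "b \<in> carrier S"
  using assms leq_subset by auto

lemma less_carrier: "(a, b) \<in> less \<Longrightarrow> a \<in> carrier S \<and> b \<in> carrier S"
  using leq_subset by blast

lemma not_less: "\<lbrakk>a \<in> carrier S; b \<in> carrier S; (a, b) \<notin> less\<rbrakk> \<Longrightarrow> (b, a) \<in> leq"
  using total leq_refl[of a] unfolding total_on_def by (cases "a = b") auto

lemma wf_less: "wf less"
  unfolding wf_iff_no_infinite_down_chain
proof
  assume "\<exists>x. \<forall>i. (x (Suc i), x i) \<in> less"
  then obtain x where x: "\<And>i. (x (Suc i), x i) \<in> less" by blast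
  with artinian show False
    unfolding artinian_on_def using less_carrier by blast
qed

lemma artinian_subset: "T \<subseteq> carrier S \<Longrightarrow> artinian_on T leq"
  using artinian unfolding artinian_on_def by blast

lemma narrow_subset:
  assumes "T \<subseteq> carrier S"
  shows "narrow_on T leq"
  unfolding narrow_on_def
proof (intro allI impI)
  fix B
  assume B: "B \<subseteq> T" "\<forall>a\<in>B. \<forall>b\<in>B. a \<noteq> b \<longrightarrow> (a, b) \<notin> leq \<and> (b, a) \<notin> leq"
  then have "a = b" if "a \<in> B" "b \<in> B" for a b
    using that assms total unfolding total_on_def by blast
  then have "B \<subseteq> {b}" if "b \<in> B" for b
    using that by blast
  then show "finite B"
    by (metis equals0I finite.emptyI finite_insert finite_subset)
qed

text \<open>An element below the identity would have a strictly decreasing sequence of powers.\<close>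

lemma one_least:
  assumes s: "s \<in> carrier S"
  shows "(\<one>, s) \<in> leq"
proof (rule ccontr)
  assume "(\<one>, s) \<notin> leq"
  then have "(s, \<one>) \<in> less"
    using not_less[of s \<one>] s by blast
  then have "(s [^] Suc i, s [^] i) \<in> less" for i :: nat
    using mult_strict_mono[of s \<one> "s [^] i"] s by simp
  then have "\<exists>x. \<forall>i. (x (Suc i), x i) \<in> less"
    by (intro exI[of _ "\<lambda>i::nat. s [^] i"]) simp
  then show False
    using wf_less by (simp add: wf_iff_no_infinite_down_chain)
qed

lemma mult_less:
  assumes "(u, u') \<in> leq" "(v, v') \<in> leq" "(u, v) \<noteq> (u', v')"
  shows "(u \<otimes> v, u' \<otimes> v') \<in> less"
proof -
  have S: "u \<in> carrier S" "u' \<in> carrier S" "v \<in> carrier S" "v' \<in> carrier S"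
    using assms(1,2)[THEN leq_carrier(1)] assms(1,2)[THEN leq_carrier(2)] by auto
  have le: "(u \<otimes> v, u' \<otimes> v) \<in> leq" "(u' \<otimes> v, u' \<otimes> v') \<in> leq"
    using mult_mono[of u u' v] mult_mono[of v v' u'] assms(1,2) S by blast+
  have "u \<noteq> u' \<or> v \<noteq> v'"
    using assms(3) by blast
  then have "(u \<otimes> v, u' \<otimes> v) \<in> less \<or> (u' \<otimes> v, u' \<otimes> v') \<in> less"
    using mult_strict_mono[of u u' v] mult_strict_mono[of v v' u'] assms(1,2) S by blast
  moreover have "(u \<otimes> v, u' \<otimes> v') \<in> leq"
    using leq_trans le .
  moreover have "u \<otimes> v = u' \<otimes> v" if "u \<otimes> v = u' \<otimes> v'"
    using leq_antisym[OF le(1)] le(2) that by simp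
  ultimately show ?thesis
    by auto
qed

lemma left_cancel:
  assumes "u \<otimes> v = u \<otimes> w" "u \<in> carrier S" "v \<in> carrier S" "w \<in> carrier S"
  shows "v = w"
proof (rule ccontr)
  assume "v \<noteq> w"
  then have "(v, w) \<in> less \<or> (w, v) \<in> less"
    using assms not_less[of v w] by blast
  then have "(u \<otimes> v, u \<otimes> w) \<in> less \<or> (u \<otimes> w, u \<otimes> v) \<in> less"
    using mult_strict_mono[of v w u] mult_strict_mono[of w v u] assms by blast
  then show False
    using assms(1) by simp
qed

definition factorizations :: "'a \<Rightarrow> ('a \<times> 'a) set" where
  "factorizations s = {(u, v) \<in> carrier S \<times> carrier S. u \<otimes> v = s}"

lemma in_factorizations_iff:
  "(u, v) \<in> factorizations s \<longleftrightarrow> u \<in> carrier S \<and> v \<in> carrier S \<and> u \<otimes> v = s"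
  by (auto simp: factorizations_def)

text \<open>Along the factorizations of an element the two factors move in opposite directions, so
  the order of the first factors and its converse are both well-founded.\<close>

lemma finite_factorizations: "finite (factorizations s)"
proof (rule finite_if_wf_and_converse_wf)
  let ?r = "{(p, q) \<in> factorizations s \<times> factorizations s. (fst p, fst q) \<in> less}"
  have anti: "(snd q, snd p) \<in> less" if "(p, q) \<in> ?r" for p q
  proof (rule ccontr)
    assume "(snd q, snd p) \<notin> less"
    then have "(snd p, snd q) \<in> leq"
      using that by (intro not_less) (auto simp: factorizations_def)
    then have "(fst p \<otimes> snd p, fst q \<otimes> snd q) \<in> less"
      using that mult_less[of "fst p" "fst q" "snd p" "snd q"] by auto
    then show False
      using that unfolding factorizations_def by auto
  qed
  show "total_on (factorizations s) ?r"
    unfolding total_on_def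
  proof (intro ballI impI)
    fix p q
    assume pq: "p \<in> factorizations s" "q \<in> factorizations s" "p \<noteq> q"
    then have S: "fst p \<in> carrier S" "fst q \<in> carrier S" "snd p \<in> carrier S" "snd q \<in> carrier S"
      and "fst p \<otimes> snd p = fst q \<otimes> snd q"
      by (simp_all add: factorizations_def case_prod_unfold mem_Times_iff)
    then have "fst p \<noteq> fst q"
      using pq(3) left_cancel[of "fst p" "snd p" "snd q"] by (metis prod_eqI)
    then have "(fst p, fst q) \<in> less \<or> (fst q, fst p) \<in> less"
      using S total unfolding total_on_def by simp
    then show "(p, q) \<in> ?r \<or> (q, p) \<in> ?r"
      using pq by simp
  qed
  show "wf ?r"
    by (rule wf_subset[OF wf_inv_image[OF wf_less, of fst]]) (auto simp: inv_image_def)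
  show "wf (?r\<inverse>)"
    by (rule wf_subset[OF wf_inv_image[OF wf_less, of snd]]) (use anti in \<open>auto simp: inv_image_def\<close>)
qed

lemma smaller_factor:
  assumes "(u \<otimes> v, u' \<otimes> v') \<in> leq" "(u, v) \<noteq> (u', v')"
    and "u \<in> carrier S" "v \<in> carrier S" "u' \<in> carrier S" "v' \<in> carrier S"
  shows "(u, u') \<in> less \<or> (v, v') \<in> less"
proof (rule ccontr)
  assume "\<not> ?thesis"
  then have "(u', u) \<in> leq" "(v', v) \<in> leq"
    using assms by (auto intro!: not_less)
  then have "(u' \<otimes> v', u \<otimes> v) \<in> less"
    using mult_less[of u' u v' v] assms(2) by auto
  then show False
    using leq_antisym[OF assms(1)] by auto
qed

lemma proper_factorization_less:
  assumes "(u, v) \<in> factorizations s" "u \<noteq> \<one>"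
  shows "(v, s) \<in> less"
proof -
  have uv: "u \<in> carrier S" "v \<in> carrier S" "u \<otimes> v = s"
    using assms(1) unfolding factorizations_def by auto
  then show ?thesis
    using mult_less[of \<one> u v v] one_least[of u] leq_refl[of v] assms(2) by auto
qed

lemma factorizations_one: "factorizations \<one> = {(\<one>, \<one>)}"
proof -
  have "u = \<one> \<and> v = \<one>" if "u \<in> carrier S" "v \<in> carrier S" "u \<otimes> v = \<one>" for u v
    using mult_less[of \<one> u \<one> v] one_least[of u] one_least[of v] that by (cases "(u, v) = (\<one>, \<one>)") auto
  then show ?thesis
    unfolding factorizations_def by auto
qed

end

section \<open>Finite sums\<close>

lemma (in comm_monoid) finprod_Sigma:
  assumes "finite A" "\<And>a. a \<in> A \<Longrightarrow> finite (B a)"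
    and "\<And>a b. \<lbrakk>a \<in> A; b \<in> B a\<rbrakk> \<Longrightarrow> f a b \<in> carrier G"
  shows "(\<Otimes>a\<in>A. \<Otimes>b\<in>B a. f a b) = (\<Otimes>p\<in>Sigma A B. f (fst p) (snd p))"
  using assms
proof (induction A)
  case (insert a A)
  have eq: "Sigma (insert a A) B = Pair a ` B a \<union> Sigma A B"
    by auto
  have "(\<Otimes>p\<in>Sigma (insert a A) B. f (fst p) (snd p))
      = (\<Otimes>p\<in>Pair a ` B a. f (fst p) (snd p)) \<otimes> (\<Otimes>p\<in>Sigma A B. f (fst p) (snd p))"
    unfolding eq using insert by (intro finprod_Un_disjoint) auto
  also have "(\<Otimes>p\<in>Pair a ` B a. f (fst p) (snd p)) = (\<Otimes>b\<in>B a. f a b)"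
    using insert by (subst finprod_reindex) (auto simp: inj_on_def)
  finally show ?case
    using insert by (simp add: Pi_def)
qed simp

context ring
begin

lemmas finsum_Sigma = add.finprod_Sigma
lemmas finsum_mono_neutral_cong_left = add.finprod_mono_neutral_cong_left

lemma finsum_remove:
  assumes "finite A" "a \<in> A" "f \<in> A \<rightarrow> carrier R"
  shows "(\<Oplus>x\<in>A. f x) = f a \<oplus> (\<Oplus>x\<in>A - {a}. f x)"
  using assms finsum_insert[of "A - {a}" a f] by (auto simp: insert_absorb)

lemma finsum_single:
  assumes "finite A" "a \<in> A" "f a \<in> carrier R"
    and "\<And>x. \<lbrakk>x \<in> A; x \<noteq> a\<rbrakk> \<Longrightarrow> f x = \<zero>"
  shows "(\<Oplus>x\<in>A. f x) = f a"
proof -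
  have "f \<in> A \<rightarrow> carrier R"
    using assms(3,4) by (metis Pi_I zero_closed)
  moreover have "(\<Oplus>x\<in>A - {a}. f x) = \<zero>"
    using assms(4) by (intro add.finprod_one_eqI) auto
  ultimately show ?thesis
    using assms by (simp add: finsum_remove)
qed

lemma finsum_additive:
  assumes h: "h \<in> carrier R \<rightarrow> carrier R" "h \<zero> = \<zero>"
    "\<And>x y. \<lbrakk>x \<in> carrier R; y \<in> carrier R\<rbrakk> \<Longrightarrow> h (x \<oplus> y) = h x \<oplus> h y"
    and f: "f \<in> A \<rightarrow> carrier R"
  shows "h (\<Oplus>x\<in>A. f x) = (\<Oplus>x\<in>A. h (f x))"
  using f
proof (induction A rule: infinite_finite_induct)
  case (insert a A)
  then show ?case
    using h by (simp add: Pi_def)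
qed (use h in auto)

lemma finsum_in_ideal:
  assumes "ideal P R" "f \<in> A \<rightarrow> P"
  shows "(\<Oplus>x\<in>A. f x) \<in> P"
proof -
  interpret P: ideal P R by (rule assms)
  show ?thesis
    using assms(2)
  proof (induction A rule: infinite_finite_induct)
    case (insert a A)
    then have "f \<in> A \<rightarrow> carrier R" "f a \<in> carrier R"
      by (simp_all add: Pi_iff P.Icarr)
    then show ?case
      using insert by (simp add: P.a_closed)
  qed auto
qed

end

section \<open>The ring of skew power series\<close>

text \<open>Every function on a well-ordered monoid has an artinian and narrow support, so series
  are arbitrary functions, and their products may be summed over all factorizations.\<close>

locale skew_power_series = S: well_ordered_monoid S leq + ring R
  for S :: "('s, 'n) monoid_scheme" and leq and R :: "('a, 'm) ring_scheme" (structure) +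
  fixes \<omega> :: "'s \<Rightarrow> 'a \<Rightarrow> 'a"
  assumes hom: "monoid_homomorphism S (End_monoid R) \<omega>"
begin

abbreviation A :: "('s \<Rightarrow> 'a) ring" where
  "A \<equiv> skew_gps_ring S leq R \<omega>"

lemma omega_ring_hom: "s \<in> carrier S \<Longrightarrow> \<omega> s \<in> ring_hom R R"
  using hom unfolding monoid_homomorphism_def hom_def End_monoid_def by auto

lemma omega_closed [simp]: "\<lbrakk>s \<in> carrier S; a \<in> carrier R\<rbrakk> \<Longrightarrow> \<omega> s a \<in> carrier R"
  and omega_mult: "\<lbrakk>s \<in> carrier S; a \<in> carrier R; b \<in> carrier R\<rbrakk> \<Longrightarrow> \<omega> s (a \<otimes> b) = \<omega> s a \<otimes> \<omega> s b"
  and omega_add: "\<lbrakk>s \<in> carrier S; a \<in> carrier R; b \<in> carrier R\<rbrakk> \<Longrightarrow> \<omega> s (a \<oplus> b) = \<omega> s a \<oplus> \<omega> s b"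
  and omega_one [simp]: "s \<in> carrier S \<Longrightarrow> \<omega> s \<one> = \<one>"
  and omega_zero [simp]: "s \<in> carrier S \<Longrightarrow> \<omega> s \<zero> = \<zero>"
  using omega_ring_hom[of s] ring_hom_zero[OF _ ring_axioms ring_axioms]
  by (auto simp: ring_hom_closed ring_hom_mult ring_hom_add ring_hom_one)

lemma omega_comp:
  assumes "s \<in> carrier S" "t \<in> carrier S" "a \<in> carrier R"
  shows "\<omega> (s \<otimes>\<^bsub>S\<^esub> t) a = \<omega> s (\<omega> t a)"
proof -
  have "\<omega> (s \<otimes>\<^bsub>S\<^esub> t) = compose (carrier R) (\<omega> s) (\<omega> t)"
    using hom assms(1,2) unfolding monoid_homomorphism_def hom_def End_monoid_def by simp
  then show ?thesis
    using assms(3) by (simp add: compose_def)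
qed

lemma omega_at_one [simp]: "a \<in> carrier R \<Longrightarrow> \<omega> \<one>\<^bsub>S\<^esub> a = a"
  using hom unfolding monoid_homomorphism_def End_monoid_def by simp

lemma carrier_A: "carrier A = carrier S \<rightarrow>\<^sub>E carrier R"
  using S.artinian_subset S.narrow_subset by (auto simp: skew_gps_ring_def supp_def)

lemma coeff_closed [simp]: "\<lbrakk>f \<in> carrier A; s \<in> carrier S\<rbrakk> \<Longrightarrow> f s \<in> carrier R"
  unfolding carrier_A by blast

lemma series_eqI:
  assumes "f \<in> carrier A" "g \<in> carrier A" "\<And>s. s \<in> carrier S \<Longrightarrow> f s = g s"
  shows "f = g"
  using assms unfolding carrier_A by (intro PiE_ext)

lemma zero_apply [simp]: "s \<in> carrier S \<Longrightarrow> \<zero>\<^bsub>A\<^esub> s = \<zero>"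
  and one_apply: "s \<in> carrier S \<Longrightarrow> \<one>\<^bsub>A\<^esub> s = (if s = \<one>\<^bsub>S\<^esub> then \<one> else \<zero>)"
  and add_apply [simp]: "s \<in> carrier S \<Longrightarrow> (f \<oplus>\<^bsub>A\<^esub> g) s = f s \<oplus> g s"
  by (simp_all add: skew_gps_ring_def)

lemma factorizationsD:
  assumes "p \<in> S.factorizations s"
  shows "fst p \<in> carrier S" "snd p \<in> carrier S" "fst p \<otimes>\<^bsub>S\<^esub> snd p = s"
  using assms by (auto simp: S.factorizations_def)

lemmas factors_closed =
  factorizationsD(1,2) factorizationsD(1,2)[of "(u, v)" for u v, simplified]

lemma mult_apply:
  assumes f: "f \<in> carrier A" and g: "g \<in> carrier A" and s: "s \<in> carrier S"
  shows "(f \<otimes>\<^bsub>A\<^esub> g) s = (\<Oplus>p\<in>S.factorizations s. f (fst p) \<otimes> \<omega> (fst p) (g (snd p)))"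
proof -
  have "(f \<otimes>\<^bsub>A\<^esub> g) s = (\<Oplus>p\<in>factor_pairs S R s f g. f (fst p) \<otimes> \<omega> (fst p) (g (snd p)))"
    using s by (simp add: skew_gps_ring_def)
  also have "\<dots> = (\<Oplus>p\<in>S.factorizations s. f (fst p) \<otimes> \<omega> (fst p) (g (snd p)))"
  proof (rule finsum_mono_neutral_cong_left)
    show "factor_pairs S R s f g \<subseteq> S.factorizations s"
      by (auto simp: factor_pairs_def S.factorizations_def supp_def)
    show "f (fst p) \<otimes> \<omega> (fst p) (g (snd p)) = \<zero>"
      if "p \<in> S.factorizations s - factor_pairs S R s f g" for p
    proof -
      have "f (fst p) = \<zero> \<or> g (snd p) = \<zero>"
        using that by (auto simp: factor_pairs_def S.factorizations_def supp_def)
      then show ?thesis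
        using that f g by (auto simp: factors_closed)
    qed
  qed (use f g in \<open>auto simp: S.finite_factorizations factors_closed\<close>)
  finally show ?thesis .
qed

lemma add_in_carrier: "\<lbrakk>f \<in> carrier A; g \<in> carrier A\<rbrakk> \<Longrightarrow> f \<oplus>\<^bsub>A\<^esub> g \<in> carrier A"
  unfolding carrier_A by (auto simp: skew_gps_ring_def)

lemma mult_in_carrier:
  assumes "f \<in> carrier A" "g \<in> carrier A"
  shows "f \<otimes>\<^bsub>A\<^esub> g \<in> carrier A"
proof -
  have "(f \<otimes>\<^bsub>A\<^esub> g) s \<in> carrier R" if "s \<in> carrier S" for s
    using assms that by (auto simp: mult_apply factors_closed intro!: finsum_closed)
  moreover have "f \<otimes>\<^bsub>A\<^esub> g \<in> extensional (carrier S)"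
    by (simp add: skew_gps_ring_def)
  ultimately show ?thesis
    unfolding carrier_A by (auto simp: PiE_def)
qed

lemma zero_in_carrier: "\<zero>\<^bsub>A\<^esub> \<in> carrier A" and one_in_carrier: "\<one>\<^bsub>A\<^esub> \<in> carrier A"
  unfolding carrier_A by (auto simp: skew_gps_ring_def)

lemma abelian_group_A: "abelian_group A"
proof (rule abelian_groupI)
  show "\<exists>g\<in>carrier A. g \<oplus>\<^bsub>A\<^esub> f = \<zero>\<^bsub>A\<^esub>" if f: "f \<in> carrier A" for f
  proof
    show g: "(\<lambda>s\<in>carrier S. \<ominus> f s) \<in> carrier A"
      using f unfolding carrier_A by auto
    show "(\<lambda>s\<in>carrier S. \<ominus> f s) \<oplus>\<^bsub>A\<^esub> f = \<zero>\<^bsub>A\<^esub>"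
      using f by (intro series_eqI add_in_carrier g zero_in_carrier) (auto simp: l_neg)
  qed
qed (auto simp: add_in_carrier zero_in_carrier a_ac intro!: series_eqI)

text \<open>Both ways of bracketing a product sum over the factorizations into three factors.\<close>

lemma mult_assoc_A:
  assumes f: "f \<in> carrier A" and g: "g \<in> carrier A" and h: "h \<in> carrier A"
  shows "(f \<otimes>\<^bsub>A\<^esub> g) \<otimes>\<^bsub>A\<^esub> h = f \<otimes>\<^bsub>A\<^esub> (g \<otimes>\<^bsub>A\<^esub> h)"
proof (rule series_eqI)
  fix s
  assume s: "s \<in> carrier S"
  let ?F = "S.factorizations"
  define T where "T u v w = f u \<otimes> (\<omega> u (g v) \<otimes> \<omega> (u \<otimes>\<^bsub>S\<^esub> v) (h w))" for u v w
  have T: "T u v w \<in> carrier R" if "u \<in> carrier S" "v \<in> carrier S" "w \<in> carrier S" for u v w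
    using that f g h by (simp add: T_def)
  let ?L = "Sigma (?F s) (\<lambda>p. ?F (fst p))"
  let ?R = "Sigma (?F s) (\<lambda>p. ?F (snd p))"
  have L: "((f \<otimes>\<^bsub>A\<^esub> g) \<otimes>\<^bsub>A\<^esub> h) s = (\<Oplus>z\<in>?L. T (fst (snd z)) (snd (snd z)) (snd (fst z)))"
  proof -
    have "((f \<otimes>\<^bsub>A\<^esub> g) \<otimes>\<^bsub>A\<^esub> h) s = (\<Oplus>p\<in>?F s. \<Oplus>q\<in>?F (fst p). T (fst q) (snd q) (snd p))"
      unfolding mult_apply[OF mult_in_carrier[OF f g] h s]
    proof (rule finsum_cong'[OF refl])
      fix p
      assume p: "p \<in> ?F s"
      note pS = factorizationsD[OF p]
      have "(f \<otimes>\<^bsub>A\<^esub> g) (fst p) \<otimes> \<omega> (fst p) (h (snd p))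
          = (\<Oplus>q\<in>?F (fst p). f (fst q) \<otimes> \<omega> (fst q) (g (snd q)) \<otimes> \<omega> (fst p) (h (snd p)))"
        using pS f g h
        by (simp add: mult_apply) (rule finsum_ldistr, auto simp: S.finite_factorizations factors_closed)
      also have "\<dots> = (\<Oplus>q\<in>?F (fst p). T (fst q) (snd q) (snd p))"
      proof (rule finsum_cong'[OF refl])
        show "(\<lambda>q. T (fst q) (snd q) (snd p)) \<in> ?F (fst p) \<rightarrow> carrier R"
          using pS by (auto simp: factors_closed intro!: T)
        show "f (fst q) \<otimes> \<omega> (fst q) (g (snd q)) \<otimes> \<omega> (fst p) (h (snd p)) = T (fst q) (snd q) (snd p)"
          if q: "q \<in> ?F (fst p)" for q
          using pS factorizationsD[OF q] f g h by (simp add: T_def m_assoc)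
      qed
      finally show "(f \<otimes>\<^bsub>A\<^esub> g) (fst p) \<otimes> \<omega> (fst p) (h (snd p))
          = (\<Oplus>q\<in>?F (fst p). T (fst q) (snd q) (snd p))" .
    qed (auto simp: factors_closed intro!: finsum_closed T)
    also have "\<dots> = (\<Oplus>z\<in>?L. T (fst (snd z)) (snd (snd z)) (snd (fst z)))"
      by (rule finsum_Sigma) (auto simp: S.finite_factorizations factors_closed intro!: T)
    finally show ?thesis .
  qed
  have R: "(f \<otimes>\<^bsub>A\<^esub> (g \<otimes>\<^bsub>A\<^esub> h)) s = (\<Oplus>z\<in>?R. T (fst (fst z)) (fst (snd z)) (snd (snd z)))"
  proof -
    have "(f \<otimes>\<^bsub>A\<^esub> (g \<otimes>\<^bsub>A\<^esub> h)) s = (\<Oplus>p\<in>?F s. \<Oplus>q\<in>?F (snd p). T (fst p) (fst q) (snd q))"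
      unfolding mult_apply[OF f mult_in_carrier[OF g h] s]
    proof (rule finsum_cong'[OF refl])
      fix p
      assume p: "p \<in> ?F s"
      note pS = factorizationsD[OF p]
      have "\<omega> (fst p) ((g \<otimes>\<^bsub>A\<^esub> h) (snd p))
          = (\<Oplus>q\<in>?F (snd p). \<omega> (fst p) (g (fst q) \<otimes> \<omega> (fst q) (h (snd q))))"
        unfolding mult_apply[OF g h pS(2)]
        using pS g h
        by (intro finsum_additive) (auto simp: factors_closed omega_add)
      then have "f (fst p) \<otimes> \<omega> (fst p) ((g \<otimes>\<^bsub>A\<^esub> h) (snd p))
          = (\<Oplus>q\<in>?F (snd p). f (fst p) \<otimes> \<omega> (fst p) (g (fst q) \<otimes> \<omega> (fst q) (h (snd q))))"
        using pS f g h
        by simp (rule finsum_rdistr, auto simp: S.finite_factorizations factors_closed)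
      also have "\<dots> = (\<Oplus>q\<in>?F (snd p). T (fst p) (fst q) (snd q))"
      proof (rule finsum_cong'[OF refl])
        show "(\<lambda>q. T (fst p) (fst q) (snd q)) \<in> ?F (snd p) \<rightarrow> carrier R"
          using pS by (auto simp: factors_closed intro!: T)
        show "f (fst p) \<otimes> \<omega> (fst p) (g (fst q) \<otimes> \<omega> (fst q) (h (snd q))) = T (fst p) (fst q) (snd q)"
          if q: "q \<in> ?F (snd p)" for q
          using pS factorizationsD[OF q] f g h by (simp add: T_def omega_mult omega_comp)
      qed
      finally show "f (fst p) \<otimes> \<omega> (fst p) ((g \<otimes>\<^bsub>A\<^esub> h) (snd p))
          = (\<Oplus>q\<in>?F (snd p). T (fst p) (fst q) (snd q))" .
    qed (auto simp: factors_closed intro!: finsum_closed T)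
    also have "\<dots> = (\<Oplus>z\<in>?R. T (fst (fst z)) (fst (snd z)) (snd (snd z)))"
      by (rule finsum_Sigma) (auto simp: S.finite_factorizations factors_closed intro!: T)
    finally show ?thesis .
  qed
  \<comment> \<open>The bijection sends \<open>((u, v w), (v, w))\<close> to \<open>((u v, w), (u, v))\<close>.\<close>
  define \<phi> where "\<phi> z = ((fst (fst z) \<otimes>\<^bsub>S\<^esub> fst (snd z), snd (snd z)), (fst (fst z), fst (snd z)))"
    for z :: "('s \<times> 's) \<times> ('s \<times> 's)"
  have image: "\<phi> ` ?R = ?L"
  proof (intro equalityI subsetI)
    fix z
    assume "z \<in> ?L"
    then have "((fst (snd z), snd (snd z) \<otimes>\<^bsub>S\<^esub> snd (fst z)), (snd (snd z), snd (fst z))) \<in> ?R"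
      "z = \<phi> ((fst (snd z), snd (snd z) \<otimes>\<^bsub>S\<^esub> snd (fst z)), (snd (snd z), snd (fst z)))"
      by (auto simp: S.factorizations_def \<phi>_def S.m_assoc)
    then show "z \<in> \<phi> ` ?R"
      by (rule rev_image_eqI)
  qed (auto simp: S.factorizations_def \<phi>_def S.m_assoc)
  have inj: "inj_on \<phi> ?R"
    by (auto simp: inj_on_def \<phi>_def S.factorizations_def)
  have "(\<Oplus>z\<in>\<phi> ` ?R. T (fst (snd z)) (snd (snd z)) (snd (fst z)))
      = (\<Oplus>z\<in>?R. T (fst (snd (\<phi> z))) (snd (snd (\<phi> z))) (snd (fst (\<phi> z))))"
    using inj unfolding image by (intro finsum_reindex[of _ \<phi> ?R, unfolded image]) (auto simp: factors_closed intro!: T)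
  then show "((f \<otimes>\<^bsub>A\<^esub> g) \<otimes>\<^bsub>A\<^esub> h) s = (f \<otimes>\<^bsub>A\<^esub> (g \<otimes>\<^bsub>A\<^esub> h)) s"
    unfolding L R image by (simp add: \<phi>_def)
qed (use assms in \<open>auto intro: mult_in_carrier\<close>)

lemma mult_at_one:
  assumes "f \<in> carrier A" "g \<in> carrier A"
  shows "(f \<otimes>\<^bsub>A\<^esub> g) \<one>\<^bsub>S\<^esub> = f \<one>\<^bsub>S\<^esub> \<otimes> g \<one>\<^bsub>S\<^esub>"
  using assms by (simp add: mult_apply S.factorizations_one)

lemma monoid_A: "monoid A"
proof (rule monoidI)
  fix f
  assume f: "f \<in> carrier A"
  show "\<one>\<^bsub>A\<^esub> \<otimes>\<^bsub>A\<^esub> f = f"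
  proof (rule series_eqI)
    fix s
    assume s: "s \<in> carrier S"
    have "(\<one>\<^bsub>A\<^esub> \<otimes>\<^bsub>A\<^esub> f) s = \<one>\<^bsub>A\<^esub> (fst (\<one>\<^bsub>S\<^esub>, s)) \<otimes> \<omega> (fst (\<one>\<^bsub>S\<^esub>, s)) (f (snd (\<one>\<^bsub>S\<^esub>, s)))"
      unfolding mult_apply[OF one_in_carrier f s]
      using f s
      by (intro finsum_single)
         (auto simp: S.finite_factorizations S.in_factorizations_iff one_apply split: if_splits)
    then show "(\<one>\<^bsub>A\<^esub> \<otimes>\<^bsub>A\<^esub> f) s = f s"
      using f s by (simp add: one_apply)
  qed (use f in \<open>auto simp: mult_in_carrier one_in_carrier\<close>)
  show "f \<otimes>\<^bsub>A\<^esub> \<one>\<^bsub>A\<^esub> = f"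
  proof (rule series_eqI)
    fix s
    assume s: "s \<in> carrier S"
    have "(f \<otimes>\<^bsub>A\<^esub> \<one>\<^bsub>A\<^esub>) s = f (fst (s, \<one>\<^bsub>S\<^esub>)) \<otimes> \<omega> (fst (s, \<one>\<^bsub>S\<^esub>)) (\<one>\<^bsub>A\<^esub> (snd (s, \<one>\<^bsub>S\<^esub>)))"
      unfolding mult_apply[OF f one_in_carrier s]
      using f s
      by (intro finsum_single)
         (auto simp: S.finite_factorizations S.in_factorizations_iff one_apply split: if_splits)
    then show "(f \<otimes>\<^bsub>A\<^esub> \<one>\<^bsub>A\<^esub>) s = f s"
      using f s by (simp add: one_apply)
  qed (use f in \<open>auto simp: mult_in_carrier one_in_carrier\<close>)
qed (auto simp: mult_in_carrier one_in_carrier mult_assoc_A)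

lemma ring_A: "ring A"
proof (rule ringI[OF abelian_group_A monoid_A])
  fix f g h
  assume C: "f \<in> carrier A" "g \<in> carrier A" "h \<in> carrier A"
  show "(f \<oplus>\<^bsub>A\<^esub> g) \<otimes>\<^bsub>A\<^esub> h = f \<otimes>\<^bsub>A\<^esub> h \<oplus>\<^bsub>A\<^esub> g \<otimes>\<^bsub>A\<^esub> h"
  proof (rule series_eqI)
    fix s
    assume s: "s \<in> carrier S"
    have "((f \<oplus>\<^bsub>A\<^esub> g) \<otimes>\<^bsub>A\<^esub> h) s
        = (\<Oplus>p\<in>S.factorizations s. f (fst p) \<otimes> \<omega> (fst p) (h (snd p)) \<oplus> g (fst p) \<otimes> \<omega> (fst p) (h (snd p)))"
      unfolding mult_apply[OF add_in_carrier[OF C(1,2)] C(3) s]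
      using C by (intro finsum_cong') (auto simp: factors_closed l_distr)
    also have "\<dots> = (f \<otimes>\<^bsub>A\<^esub> h \<oplus>\<^bsub>A\<^esub> g \<otimes>\<^bsub>A\<^esub> h) s"
      using C s by (simp add: mult_apply) (rule finsum_addf, auto simp: factors_closed)
    finally show "((f \<oplus>\<^bsub>A\<^esub> g) \<otimes>\<^bsub>A\<^esub> h) s = (f \<otimes>\<^bsub>A\<^esub> h \<oplus>\<^bsub>A\<^esub> g \<otimes>\<^bsub>A\<^esub> h) s" .
  qed (use C in \<open>auto simp: mult_in_carrier add_in_carrier\<close>)
  show "h \<otimes>\<^bsub>A\<^esub> (f \<oplus>\<^bsub>A\<^esub> g) = h \<otimes>\<^bsub>A\<^esub> f \<oplus>\<^bsub>A\<^esub> h \<otimes>\<^bsub>A\<^esub> g"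
  proof (rule series_eqI)
    fix s
    assume s: "s \<in> carrier S"
    have "(h \<otimes>\<^bsub>A\<^esub> (f \<oplus>\<^bsub>A\<^esub> g)) s
        = (\<Oplus>p\<in>S.factorizations s. h (fst p) \<otimes> \<omega> (fst p) (f (snd p)) \<oplus> h (fst p) \<otimes> \<omega> (fst p) (g (snd p)))"
      unfolding mult_apply[OF C(3) add_in_carrier[OF C(1,2)] s]
      using C by (intro finsum_cong') (auto simp: factors_closed r_distr omega_add)
    also have "\<dots> = (h \<otimes>\<^bsub>A\<^esub> f \<oplus>\<^bsub>A\<^esub> h \<otimes>\<^bsub>A\<^esub> g) s"
      using C s by (simp add: mult_apply) (rule finsum_addf, auto simp: factors_closed)
    finally show "(h \<otimes>\<^bsub>A\<^esub> (f \<oplus>\<^bsub>A\<^esub> g)) s = (h \<otimes>\<^bsub>A\<^esub> f \<oplus>\<^bsub>A\<^esub> h \<otimes>\<^bsub>A\<^esub> g) s" .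
  qed (use C in \<open>auto simp: mult_in_carrier add_in_carrier\<close>)
qed

end

sublocale skew_power_series \<subseteq> A: ring A
  by (rule ring_A)

context skew_power_series
begin

lemma power_at_one: "f \<in> carrier A \<Longrightarrow> (f [^]\<^bsub>A\<^esub> n) \<one>\<^bsub>S\<^esub> = f \<one>\<^bsub>S\<^esub> [^] (n::nat)"
  by (induction n) (simp_all add: one_apply mult_at_one)

section \<open>Units\<close>

text \<open>In the product of \<open>f\<close> and \<open>g\<close> the coefficient at \<open>s\<close> is \<open>f \<one> \<otimes> g s\<close> plus a sum over
  values of \<open>g\<close> at elements strictly below \<open>s\<close>; hence if \<open>f \<one>\<close> is a unit, a right inverse \<open>g\<close> can be
  defined by well-founded recursion.\<close>

lemma right_inverse_exists:
  assumes f: "f \<in> carrier A" and unit: "f \<one>\<^bsub>S\<^esub> \<in> Units R"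
  shows "\<exists>g\<in>carrier A. f \<otimes>\<^bsub>A\<^esub> g = \<one>\<^bsub>A\<^esub>"
proof -
  define rest where "rest g s =
      (\<Oplus>p\<in>S.factorizations s - {(\<one>\<^bsub>S\<^esub>, s)}. f (fst p) \<otimes> \<omega> (fst p) (g (snd p)))" for g s
  define H where "H g s = inv (f \<one>\<^bsub>S\<^esub>) \<otimes> (\<one>\<^bsub>A\<^esub> s \<ominus> rest g s)" for g s
  have below: "(snd p, s) \<in> S.less" if "p \<in> S.factorizations s - {(\<one>\<^bsub>S\<^esub>, s)}" for p s
  proof (rule S.proper_factorization_less)
    show "(fst p, snd p) \<in> S.factorizations s"
      using that by simp
    show "fst p \<noteq> \<one>\<^bsub>S\<^esub>"
      using that by (auto simp: S.factorizations_def)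
  qed
  define g0 where "g0 = wfrec S.less H"
  have unfold: "g0 s = H (cut g0 S.less s) s" for s
    unfolding g0_def by (rule wfrec[OF S.wf_less])
  have rest_closed: "rest g s \<in> carrier R"
    if "\<And>t. (t, s) \<in> S.less \<Longrightarrow> g t \<in> carrier R" for g s
    unfolding rest_def
  proof (intro finsum_closed funcsetI)
    fix p
    assume p: "p \<in> S.factorizations s - {(\<one>\<^bsub>S\<^esub>, s)}"
    then show "f (fst p) \<otimes> \<omega> (fst p) (g (snd p)) \<in> carrier R"
      using f that[OF below[OF p]] by (auto simp: factors_closed)
  qed
  have closed: "s \<in> carrier S \<longrightarrow> g0 s \<in> carrier R" for s
    using S.wf_less
  proof (induction s)
    case (less s)
    have "rest (cut g0 S.less s) s \<in> carrier R"
      using less S.less_carrier by (intro rest_closed) (simp add: cut_apply)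
    then show ?case
      using unit one_in_carrier unfolding unfold[of s] H_def by (auto simp: Units_inv_closed)
  qed
  define g where "g = restrict g0 (carrier S)"
  have g: "g \<in> carrier A"
    using closed unfolding carrier_A g_def by auto
  have g_eq: "g s = H g s" if s: "s \<in> carrier S" for s
  proof -
    have "rest (cut g0 S.less s) s = rest g s"
      unfolding rest_def
    proof (rule finsum_cong'[OF refl])
      fix p
      assume p: "p \<in> S.factorizations s - {(\<one>\<^bsub>S\<^esub>, s)}"
      then show "f (fst p) \<otimes> \<omega> (fst p) (cut g0 S.less s (snd p)) = f (fst p) \<otimes> \<omega> (fst p) (g (snd p))"
        using below[OF p] by (auto simp: cut_apply g_def factors_closed)
    qed (use f g in \<open>auto simp: factors_closed\<close>)
    then show ?thesis
      using s unfold[of s] by (simp add: g_def H_def)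
  qed
  have "f \<otimes>\<^bsub>A\<^esub> g = \<one>\<^bsub>A\<^esub>"
  proof (rule series_eqI)
    fix s
    assume s: "s \<in> carrier S"
    have r: "rest g s \<in> carrier R"
      using g S.less_carrier by (intro rest_closed) simp
    have "(f \<otimes>\<^bsub>A\<^esub> g) s = f (fst (\<one>\<^bsub>S\<^esub>, s)) \<otimes> \<omega> (fst (\<one>\<^bsub>S\<^esub>, s)) (g (snd (\<one>\<^bsub>S\<^esub>, s))) \<oplus> rest g s"
      unfolding mult_apply[OF f g s] rest_def
      using f g s
      by (intro finsum_remove) (auto simp: S.finite_factorizations S.in_factorizations_iff)
    also have "\<dots> = f \<one>\<^bsub>S\<^esub> \<otimes> g s \<oplus> rest g s"
      using g s by simp
    also have "f \<one>\<^bsub>S\<^esub> \<otimes> g s = \<one>\<^bsub>A\<^esub> s \<ominus> rest g s"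
      using unit r s one_in_carrier f unfolding g_eq[OF s] H_def
      by (simp add: m_assoc[symmetric] Units_inv_closed Units_r_inv)
    finally show "(f \<otimes>\<^bsub>A\<^esub> g) s = \<one>\<^bsub>A\<^esub> s"
      using r s one_in_carrier by (simp add: minus_eq a_assoc l_neg)
  qed (use f g in auto)
  then show ?thesis
    using g by blast
qed

text \<open>The right inverse of \<open>f\<close> again has a unit at \<open>\<one>\<close>, hence a right inverse of its own,
  which must be \<open>f\<close>.\<close>

lemma unit_if_unit_at_one:
  assumes f: "f \<in> carrier A" and unit: "f \<one>\<^bsub>S\<^esub> \<in> Units R"
  shows "f \<in> Units A"
proof -
  obtain g where g: "g \<in> carrier A" "f \<otimes>\<^bsub>A\<^esub> g = \<one>\<^bsub>A\<^esub>"
    using right_inverse_exists assms by blast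
  have "f \<one>\<^bsub>S\<^esub> \<otimes> g \<one>\<^bsub>S\<^esub> = \<one>"
    using mult_at_one[OF f g(1)] g(2) by (simp add: one_apply)
  then have "g \<one>\<^bsub>S\<^esub> = inv (f \<one>\<^bsub>S\<^esub>)"
    using unit g(1) inv_unique[of "inv (f \<one>\<^bsub>S\<^esub>)" "f \<one>\<^bsub>S\<^esub>" "g \<one>\<^bsub>S\<^esub>"]
    by (simp add: Units_closed)
  then have "g \<one>\<^bsub>S\<^esub> \<in> Units R"
    using unit by simp
  then obtain h where h: "h \<in> carrier A" "g \<otimes>\<^bsub>A\<^esub> h = \<one>\<^bsub>A\<^esub>"
    using right_inverse_exists g by blast
  have "f = h"
    using A.inv_unique[of f g h] f g h by simp
  then show ?thesis
    using f g h unfolding Units_def by auto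
qed

end

section \<open>Annihilators in reduced rings\<close>

context ring
begin

lemma reduced_iff_no_square_zero:
  "reduced R \<longleftrightarrow> (\<forall>a\<in>carrier R. a \<otimes> a = \<zero> \<longrightarrow> a = \<zero>)"
proof
  assume red: "reduced R"
  show "\<forall>a\<in>carrier R. a \<otimes> a = \<zero> \<longrightarrow> a = \<zero>"
  proof (intro ballI impI)
    fix a
    assume "a \<in> carrier R" "a \<otimes> a = \<zero>"
    then have "a [^] (2::nat) = \<zero>"
      by (simp add: numeral_2_eq_2)
    then show "a = \<zero>"
      using red \<open>a \<in> carrier R\<close> unfolding reduced_def by blast
  qed
next
  assume sq: "\<forall>a\<in>carrier R. a \<otimes> a = \<zero> \<longrightarrow> a = \<zero>"
  have "a = \<zero>" if a: "a \<in> carrier R" and "a [^] n = \<zero>" for a and n :: nat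
    using that(2)
  proof (induction n)
    case 0
    \<comment> \<open>Here \<open>\<one> = \<zero>\<close>, so the ring is trivial.\<close>
    then show ?case
      using a by (metis nat_pow_0 r_null r_one)
  next
    case (Suc n)
    show ?case
    proof (cases n)
      case 0
      then show ?thesis
        using Suc.prems a by simp
    next
      case (Suc m)
      \<comment> \<open>The square of \<open>a ^ n\<close> is \<open>a ^ (n + 1) * a ^ (n - 1)\<close>.\<close>
      have "a [^] n \<otimes> a [^] n = a [^] Suc n \<otimes> a [^] m"
        using a Suc by (simp only: nat_pow_mult) simp
      then have "a [^] n \<otimes> a [^] n = \<zero>"
        using \<open>a [^] Suc n = \<zero>\<close> a by simp
      then have "a [^] n = \<zero>"
        using sq a nat_pow_closed by blast
      then show ?thesis
        by (rule Suc.IH)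
    qed
  qed
  then show "reduced R"
    unfolding reduced_def by blast
qed

lemma in_annihilator_iff: "a \<in> right_annihilator R {c} \<longleftrightarrow> a \<in> carrier R \<and> c \<otimes> a = \<zero>"
  by (auto simp: right_annihilator_def)

context
  assumes red: "reduced R"
begin

lemma square_zero: "\<lbrakk>a \<in> carrier R; a \<otimes> a = \<zero>\<rbrakk> \<Longrightarrow> a = \<zero>"
  using red reduced_iff_no_square_zero by blast

lemma zero_product_commute:
  assumes "a \<in> carrier R" "b \<in> carrier R" "a \<otimes> b = \<zero>"
  shows "b \<otimes> a = \<zero>"
proof (rule square_zero)
  have "(b \<otimes> a) \<otimes> (b \<otimes> a) = b \<otimes> (a \<otimes> b) \<otimes> a"
    using assms(1,2) by (simp add: m_assoc)
  then show "(b \<otimes> a) \<otimes> (b \<otimes> a) = \<zero>"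
    using assms by simp
qed (use assms in simp)

lemma ideal_annihilator:
  assumes c: "c \<in> carrier R"
  shows "ideal (right_annihilator R {c}) R"
proof (rule idealI[OF ring_axioms])
  show "subgroup (right_annihilator R {c}) (add_monoid R)"
  proof (rule group.subgroupI[OF a_group])
    show "inv\<^bsub>add_monoid R\<^esub> a \<in> right_annihilator R {c}"
      if "a \<in> right_annihilator R {c}" for a
      using that c unfolding a_inv_def[symmetric] in_annihilator_iff
      by (simp add: r_minus)
  next
    have "\<zero> \<in> right_annihilator R {c}"
      using c by (simp add: in_annihilator_iff)
    then show "right_annihilator R {c} \<noteq> {}" by blast
  qed (use c in \<open>auto simp: in_annihilator_iff r_distr\<close>)
  show "x \<otimes> a \<in> right_annihilator R {c}"
    if "a \<in> right_annihilator R {c}" "x \<in> carrier R" for a x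
  proof -
    have "(x \<otimes> a) \<otimes> c = \<zero>"
      using that c zero_product_commute[of c a] by (simp add: in_annihilator_iff m_assoc)
    then show ?thesis
      using that c zero_product_commute[of "x \<otimes> a" c] by (simp add: in_annihilator_iff)
  qed
qed (use c in \<open>auto simp: in_annihilator_iff m_assoc[symmetric]\<close>)

text \<open>Among the annihilators of the nonzero elements of \<open>x R\<close> the chain condition provides a
  maximal one, say of \<open>c\<close>. If \<open>a b\<close> annihilates \<open>c\<close> and \<open>a\<close> does not, then \<open>c a\<close> is again a
  nonzero element of \<open>x R\<close> whose annihilator contains that of \<open>c\<close> and \<open>b\<close>, so maximality puts \<open>b\<close>
  into the annihilator of \<open>c\<close>. Reducedness keeps \<open>x\<close> out of the annihilator of a nonzero
  multiple of \<open>x\<close>.\<close>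

lemma completely_prime_annihilator_exists:
  assumes acc: "acc_on_annihilators R" and x: "x \<in> carrier R" "x \<noteq> \<zero>"
  obtains c where "c \<in> carrier R" "x \<notin> right_annihilator R {c}"
    "\<And>a b. \<lbrakk>a \<in> carrier R; b \<in> carrier R; a \<otimes> b \<in> right_annihilator R {c}\<rbrakk>
      \<Longrightarrow> a \<in> right_annihilator R {c} \<or> b \<in> right_annihilator R {c}"
proof -
  define Q where "Q = {c. \<exists>r\<in>carrier R. c = x \<otimes> r \<and> c \<noteq> \<zero>}"
  have Q_carrier: "c \<in> carrier R" if "c \<in> Q" for c
    using that x by (auto simp: Q_def)
  have "wf {(d, c). d \<in> Q \<and> c \<in> Q \<and> right_annihilator R {c} \<subset> right_annihilator R {d}}"
    unfolding wf_iff_no_infinite_down_chain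
  proof
    assume "\<exists>s. \<forall>i. (s (Suc i), s i)
      \<in> {(d, c). d \<in> Q \<and> c \<in> Q \<and> right_annihilator R {c} \<subset> right_annihilator R {d}}"
    then obtain s where s: "\<And>i. s i \<in> Q"
      "\<And>i. right_annihilator R {s i} \<subset> right_annihilator R {s (Suc i)}"
      by simp blast
    have "\<exists>T\<subseteq>carrier R. right_annihilator R {s i} = right_annihilator R T" for i
      using Q_carrier[OF s(1)] by blast
    then have "\<exists>N. \<forall>n\<ge>N. right_annihilator R {s n} = right_annihilator R {s N}"
      using acc[unfolded acc_on_annihilators_def, rule_format, of "\<lambda>i. right_annihilator R {s i}"]
        psubset_imp_subset[OF s(2)] by blast
    then obtain N where "right_annihilator R {s (Suc N)} = right_annihilator R {s N}"
      by (meson le_Suc_eq order_refl)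
    then show False
      using s(2)[of N] by simp
  qed
  moreover have "x \<otimes> \<one> \<in> Q"
    using x unfolding Q_def by (auto intro!: bexI[of _ \<one>])
  ultimately obtain c where c: "c \<in> Q"
    and max: "\<And>d. \<lbrakk>d \<in> Q; right_annihilator R {c} \<subseteq> right_annihilator R {d}\<rbrakk>
      \<Longrightarrow> right_annihilator R {d} = right_annihilator R {c}"
    by (smt (verit, best) case_prodI mem_Collect_eq psubsetI wf_eq_minimal)
  have cR: "c \<in> carrier R"
    using c by (rule Q_carrier)
  obtain r where r: "r \<in> carrier R" "c = x \<otimes> r" "c \<noteq> \<zero>"
    using c unfolding Q_def by blast
  show thesis
  proof (rule that[OF cR])
    show "x \<notin> right_annihilator R {c}"
    proof
      assume "x \<in> right_annihilator R {c}"
      then have "c \<otimes> x = \<zero>"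
        by (simp add: in_annihilator_iff)
      then have "c \<otimes> c = \<zero>"
        using r x cR by (metis l_null m_assoc)
      then show False
        using square_zero cR r(3) by blast
    qed
    fix a b
    assume ab: "a \<in> carrier R" "b \<in> carrier R" "a \<otimes> b \<in> right_annihilator R {c}"
    show "a \<in> right_annihilator R {c} \<or> b \<in> right_annihilator R {c}"
    proof (cases "c \<otimes> a = \<zero>")
      case False
      then have "c \<otimes> a \<in> Q"
        unfolding Q_def using r x ab(1) by (auto simp: m_assoc intro!: bexI[of _ "r \<otimes> a"])
      moreover have "right_annihilator R {c} \<subseteq> right_annihilator R {c \<otimes> a}"
      proof
        fix y
        assume "y \<in> right_annihilator R {c}"
        then have y: "y \<in> carrier R" "y \<otimes> c = \<zero>"
          using zero_product_commute cR by (auto simp: in_annihilator_iff)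
        then have "y \<otimes> (c \<otimes> a) = \<zero>"
          using cR ab(1) by (simp add: m_assoc[symmetric])
        then show "y \<in> right_annihilator R {c \<otimes> a}"
          using zero_product_commute y(1) cR ab(1) by (simp add: in_annihilator_iff)
      qed
      moreover have "b \<in> right_annihilator R {c \<otimes> a}"
        using ab cR by (simp add: in_annihilator_iff m_assoc)
      ultimately show ?thesis
        using max by blast
    qed (use ab in \<open>simp add: in_annihilator_iff\<close>)
  qed
qed

end

text \<open>Rigidity says that an endomorphism cannot change which products vanish: if \<open>c a = 0\<close> then
  \<open>(c \<alpha>(a)) \<alpha>(c \<alpha>(a)) = c \<alpha>(a c) \<alpha>(\<alpha>(a)) = 0\<close>, and if \<open>c \<alpha>(a) = 0\<close>
  then \<open>(a c) \<alpha>(a c) = a (c \<alpha>(a)) \<alpha>(c) = 0\<close>.\<close>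

lemma rigid_in_annihilator_iff:
  assumes red: "reduced R" and rigid: "rigid_endomorphism R \<alpha>"
    and ac: "a \<in> carrier R" "c \<in> carrier R"
  shows "\<alpha> a \<in> right_annihilator R {c} \<longleftrightarrow> a \<in> right_annihilator R {c}"
proof -
  have \<alpha>: "\<alpha> \<in> ring_hom R R"
    and rig: "\<And>x. \<lbrakk>x \<in> carrier R; x \<otimes> \<alpha> x = \<zero>\<rbrakk> \<Longrightarrow> x = \<zero>"
    using rigid unfolding rigid_endomorphism_def by blast+
  note [simp] = ring_hom_closed[OF \<alpha>] ring_hom_mult[OF \<alpha>] ring_hom_zero[OF \<alpha> ring_axioms ring_axioms]
  have "c \<otimes> \<alpha> a = \<zero>" if "c \<otimes> a = \<zero>"
  proof (rule rig)
    have "\<alpha> a \<otimes> \<alpha> c = \<zero>"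
      using ring_hom_mult[OF \<alpha> ac] zero_product_commute[OF red ac(2,1) that] by simp
    then have "c \<otimes> (\<alpha> a \<otimes> \<alpha> c) \<otimes> \<alpha> (\<alpha> a) = \<zero>"
      using ac by simp
    then show "c \<otimes> \<alpha> a \<otimes> \<alpha> (c \<otimes> \<alpha> a) = \<zero>"
      using ac by (simp add: m_assoc)
  qed (use ac in simp)
  moreover have "c \<otimes> a = \<zero>" if "c \<otimes> \<alpha> a = \<zero>"
  proof -
    have "a \<otimes> (c \<otimes> \<alpha> a) \<otimes> \<alpha> c = \<zero>"
      using that ac by simp
    then have "a \<otimes> c \<otimes> \<alpha> (a \<otimes> c) = \<zero>"
      using ac by (simp add: m_assoc)
    then have "a \<otimes> c = \<zero>"
      using ac rig[of "a \<otimes> c"] by simp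
    then show ?thesis
      using zero_product_commute[OF red] ac by simp
  qed
  ultimately show ?thesis
    using ac by (auto simp: in_annihilator_iff)
qed

end

section \<open>Leading terms modulo an invariant completely prime ideal\<close>

locale invariant_completely_prime = skew_power_series S leq R \<omega> + P: ideal P R
  for S :: "('s, 'n) monoid_scheme" and leq and R :: "('a, 'm) ring_scheme" (structure)
    and \<omega> and P +
  assumes prime: "\<lbrakk>a \<in> carrier R; b \<in> carrier R; a \<otimes> b \<in> P\<rbrakk> \<Longrightarrow> a \<in> P \<or> b \<in> P"
    and invariant: "\<lbrakk>s \<in> carrier S; a \<in> carrier R\<rbrakk> \<Longrightarrow> \<omega> s a \<in> P \<longleftrightarrow> a \<in> P"
begin

definition leads :: "('s \<Rightarrow> 'a) \<Rightarrow> 's \<Rightarrow> bool" where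
  "leads f t \<longleftrightarrow> t \<in> carrier S \<and> f t \<notin> P \<and> (\<forall>u. (u, t) \<in> S.less \<longrightarrow> f u \<in> P)"

lemma leads_unique: "\<lbrakk>leads f s; leads f t\<rbrakk> \<Longrightarrow> s = t"
  using S.not_less[of s t] unfolding leads_def by blast

lemma leads_exists:
  assumes "s \<in> carrier S" "f s \<notin> P"
  obtains t where "leads f t"
proof -
  have "s \<in> {u \<in> carrier S. f u \<notin> P}"
    using assms by simp
  then show thesis
  proof (rule wfE_min[OF S.wf_less])
    fix t
    assume t: "t \<in> {u \<in> carrier S. f u \<notin> P}"
      and below: "\<And>u. (u, t) \<in> S.less \<Longrightarrow> u \<notin> {u \<in> carrier S. f u \<notin> P}"
    have "f u \<in> P" if "(u, t) \<in> S.less" for u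
      using below[OF that] S.less_carrier[OF that] by simp
    then have "leads f t"
      using t unfolding leads_def by simp
    then show thesis
      by (rule that)
  qed
qed

lemma term_in_ideal:
  assumes "f \<in> carrier A" "g \<in> carrier A" "u \<in> carrier S" "v \<in> carrier S"
    and "f u \<in> P \<or> g v \<in> P"
  shows "f u \<otimes> \<omega> u (g v) \<in> P"
  using assms by (auto simp: invariant intro: P.I_l_closed P.I_r_closed)

text \<open>A factorization of \<open>u v\<close> other than \<open>(u, v)\<close> has a factor below \<open>u\<close> or below \<open>v\<close>, so
  modulo \<open>P\<close> only the product of the leading terms survives.\<close>

lemma mult_leading_coeff:
  assumes f: "f \<in> carrier A" "leads f u" and g: "g \<in> carrier A" "leads g v"
  obtains p where "p \<in> P" "(f \<otimes>\<^bsub>A\<^esub> g) (u \<otimes>\<^bsub>S\<^esub> v) = f u \<otimes> \<omega> u (g v) \<oplus> p"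
proof
  let ?F = "S.factorizations (u \<otimes>\<^bsub>S\<^esub> v)"
  have uv: "u \<in> carrier S" "v \<in> carrier S"
    using f g unfolding leads_def by auto
  have "(f \<otimes>\<^bsub>A\<^esub> g) (u \<otimes>\<^bsub>S\<^esub> v) = f (fst (u, v)) \<otimes> \<omega> (fst (u, v)) (g (snd (u, v)))
      \<oplus> (\<Oplus>p\<in>?F - {(u, v)}. f (fst p) \<otimes> \<omega> (fst p) (g (snd p)))"
    unfolding mult_apply[OF f(1) g(1) S.m_closed[OF uv]]
    using f(1) g(1) uv
    by (intro finsum_remove)
       (auto simp: S.finite_factorizations S.in_factorizations_iff)
  then show "(f \<otimes>\<^bsub>A\<^esub> g) (u \<otimes>\<^bsub>S\<^esub> v) = f u \<otimes> \<omega> u (g v)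
      \<oplus> (\<Oplus>p\<in>?F - {(u, v)}. f (fst p) \<otimes> \<omega> (fst p) (g (snd p)))"
    by simp
  show "(\<Oplus>p\<in>?F - {(u, v)}. f (fst p) \<otimes> \<omega> (fst p) (g (snd p))) \<in> P"
  proof (intro finsum_in_ideal[OF P.is_ideal] funcsetI)
    fix p
    assume p: "p \<in> ?F - {(u, v)}"
    then have pS: "fst p \<in> carrier S" "snd p \<in> carrier S" "fst p \<otimes>\<^bsub>S\<^esub> snd p = u \<otimes>\<^bsub>S\<^esub> v"
      using factorizationsD[of p "u \<otimes>\<^bsub>S\<^esub> v"] by simp_all
    have "(fst p, u) \<in> S.less \<or> (snd p, v) \<in> S.less"
      using p pS uv S.leq_refl[OF S.m_closed[OF uv]] by (intro S.smaller_factor) auto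
    then show "f (fst p) \<otimes> \<omega> (fst p) (g (snd p)) \<in> P"
      using f g pS by (intro term_in_ideal) (auto simp: leads_def)
  qed
qed

lemma leads_mult:
  assumes f: "f \<in> carrier A" "leads f u" and g: "g \<in> carrier A" "leads g v"
  shows "leads (f \<otimes>\<^bsub>A\<^esub> g) (u \<otimes>\<^bsub>S\<^esub> v)"
  unfolding leads_def
proof (intro conjI allI impI)
  have uv: "u \<in> carrier S" "v \<in> carrier S" "f u \<notin> P" "g v \<notin> P"
    using f g unfolding leads_def by auto
  then show "u \<otimes>\<^bsub>S\<^esub> v \<in> carrier S" by simp
  obtain p where p: "p \<in> P" "(f \<otimes>\<^bsub>A\<^esub> g) (u \<otimes>\<^bsub>S\<^esub> v) = f u \<otimes> \<omega> u (g v) \<oplus> p"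
    using mult_leading_coeff assms by blast
  show "(f \<otimes>\<^bsub>A\<^esub> g) (u \<otimes>\<^bsub>S\<^esub> v) \<notin> P"
  proof
    assume "(f \<otimes>\<^bsub>A\<^esub> g) (u \<otimes>\<^bsub>S\<^esub> v) \<in> P"
    then have "f u \<otimes> \<omega> u (g v) \<oplus> p \<oplus> \<ominus> p \<in> P"
      using p by (auto intro: P.a_closed P.a_inv_closed)
    then have "f u \<otimes> \<omega> u (g v) \<in> P"
      using p(1) P.Icarr f g uv by (simp add: a_assoc r_neg)
    then show False
      using prime[of "f u" "\<omega> u (g v)"] invariant[of u "g v"] f g uv by auto
  qed
  fix s
  assume s: "(s, u \<otimes>\<^bsub>S\<^esub> v) \<in> S.less"
  then have sS: "s \<in> carrier S"
    using S.less_carrier by blast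
  show "(f \<otimes>\<^bsub>A\<^esub> g) s \<in> P"
    unfolding mult_apply[OF f(1) g(1) sS]
  proof (intro finsum_in_ideal[OF P.is_ideal] funcsetI)
    fix p
    assume p: "p \<in> S.factorizations s"
    note pS = factorizationsD[OF p]
    have "(fst p, snd p) \<noteq> (u, v)"
      using s pS by auto
    then have "(fst p, u) \<in> S.less \<or> (snd p, v) \<in> S.less"
      using s pS uv by (intro S.smaller_factor) auto
    then show "f (fst p) \<otimes> \<omega> (fst p) (g (snd p)) \<in> P"
      using f g pS by (intro term_in_ideal) (auto simp: leads_def)
  qed
qed

lemma leads_power:
  assumes f: "f \<in> carrier A" "leads f t"
  shows "leads (f [^]\<^bsub>A\<^esub> (n::nat)) (t [^]\<^bsub>S\<^esub> n)"
proof (induction n)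
  case 0
  have t: "t \<in> carrier S" "f t \<notin> P"
    using f unfolding leads_def by auto
  have "\<one> \<notin> P"
  proof
    assume "\<one> \<in> P"
    then have "f t \<otimes> \<one> \<in> P"
      using f t by (intro P.I_l_closed) auto
    then show False
      using f t by simp
  qed
  moreover have "(u, \<one>\<^bsub>S\<^esub>) \<notin> S.less" for u
    using S.one_least[of u] S.leq_antisym[of u "\<one>\<^bsub>S\<^esub>"] S.less_carrier by blast
  ultimately show ?case
    by (simp add: leads_def one_apply) blast
next
  case (Suc n)
  then show ?case
    using leads_mult[OF _ Suc f] f(1) by simp
qed

text \<open>Suppose \<open>g = f\<^sup>n h\<^sub>n\<close> for all \<open>n\<close>, and let \<open>f\<close>, \<open>g\<close> and \<open>h\<^sub>n\<close> lead at \<open>t\<close>, \<open>s\<close> and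
  \<open>v\<^sub>n\<close>. Then \<open>s = t\<^sup>n v\<^sub>n\<close>, and cancelling \<open>t\<^sup>n\<close> in \<open>t\<^sup>n v\<^sub>n = t\<^sup>n\<^sup>+\<^sup>1 v\<^sub>n\<^sub>+\<^sub>1\<close> gives
  \<open>v\<^sub>n = t v\<^sub>n\<^sub>+\<^sub>1\<close>. For \<open>t \<noteq> \<one>\<close> this is an infinite descent. Hence \<open>t = \<one>\<close> and \<open>s = v\<^sub>n\<close>, and the
  leading coefficient of \<open>g\<close> is, modulo \<open>P\<close>, a multiple of each power of \<open>f \<one>\<close>.\<close>

lemma leading_coeff_divisible:
  assumes f: "f \<in> carrier A" and h: "\<And>n::nat. h n \<in> carrier A"
    and g: "\<And>n. g = f [^]\<^bsub>A\<^esub> n \<otimes>\<^bsub>A\<^esub> h n"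
    and lead: "leads g s"
  shows "\<exists>y\<in>carrier R. \<exists>p\<in>P. g s = f \<one>\<^bsub>S\<^esub> [^] (n::nat) \<otimes> y \<oplus> p"
proof -
  have gA: "g \<in> carrier A"
    using g[of 0] f h by (metis A.m_closed A.nat_pow_closed)
  have sS: "s \<in> carrier S" "g s \<notin> P"
    using lead unfolding leads_def by auto
  have mult_in_P: "(a \<otimes>\<^bsub>A\<^esub> b) u \<in> P"
    if ab: "a \<in> carrier A" "b \<in> carrier A" and u: "u \<in> carrier S"
      and P: "(\<forall>v\<in>carrier S. a v \<in> P) \<or> (\<forall>v\<in>carrier S. b v \<in> P)" for a b u
    unfolding mult_apply[OF ab u]
  proof (intro finsum_in_ideal[OF P.is_ideal] funcsetI)
    fix p
    assume "p \<in> S.factorizations u"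
    then have "fst p \<in> carrier S" "snd p \<in> carrier S"
      by (rule factorizationsD)+
    then show "a (fst p) \<otimes> \<omega> (fst p) (b (snd p)) \<in> P"
      using ab P by (intro term_in_ideal) auto
  qed
  have "\<exists>t. leads f t"
  proof (rule ccontr)
    assume "\<nexists>t. leads f t"
    then have "\<forall>v\<in>carrier S. f v \<in> P"
      using leads_exists by metis
    then have "(f \<otimes>\<^bsub>A\<^esub> h 1) s \<in> P"
      using f h sS(1) by (intro mult_in_P) auto
    then show False
      using g[of 1] f sS(2) by simp
  qed
  then obtain t where t: "leads f t" by blast
  then have tS: "t \<in> carrier S"
    unfolding leads_def by blast
  have "\<exists>v. leads (h n) v" for n
  proof (rule ccontr)
    assume "\<nexists>v. leads (h n) v"
    then have "\<forall>v\<in>carrier S. h n v \<in> P"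
      using leads_exists by metis
    then have "(f [^]\<^bsub>A\<^esub> n \<otimes>\<^bsub>A\<^esub> h n) s \<in> P"
      using f h sS(1) by (intro mult_in_P) auto
    then show False
      using g[of n] sS(2) by simp
  qed
  then obtain v where v: "\<And>n. leads (h n) (v n)" by metis
  then have vS: "v n \<in> carrier S" for n
    unfolding leads_def by blast
  have s_eq: "s = t [^]\<^bsub>S\<^esub> n \<otimes>\<^bsub>S\<^esub> v n" for n
    using leads_mult[OF _ leads_power[OF f t] h v, of n n] f lead g[of n]
    by (auto intro: leads_unique)
  have "t = \<one>\<^bsub>S\<^esub>"
  proof (rule ccontr)
    assume "t \<noteq> \<one>\<^bsub>S\<^esub>"
    have "(v (Suc n), v n) \<in> S.less" for n
    proof -
      have "t [^]\<^bsub>S\<^esub> n \<otimes>\<^bsub>S\<^esub> (t \<otimes>\<^bsub>S\<^esub> v (Suc n)) = t [^]\<^bsub>S\<^esub> n \<otimes>\<^bsub>S\<^esub> v n"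
        using s_eq[of n] s_eq[of "Suc n"] tS vS by (simp add: S.m_assoc)
      then have "t \<otimes>\<^bsub>S\<^esub> v (Suc n) = v n"
        by (rule S.left_cancel) (use tS vS in auto)
      then show ?thesis
        using \<open>t \<noteq> \<one>\<^bsub>S\<^esub>\<close> tS vS
        by (intro S.proper_factorization_less[of t]) (auto simp: S.in_factorizations_iff)
    qed
    then show False
      using S.wf_less unfolding wf_iff_no_infinite_down_chain by metis
  qed
  then have vs: "v n = s"
    using s_eq[of n] vS by simp
  have one_pow: "leads (f [^]\<^bsub>A\<^esub> n) \<one>\<^bsub>S\<^esub>"
    using leads_power[OF f t, of n] \<open>t = \<one>\<^bsub>S\<^esub>\<close> by simp
  obtain p where "p \<in> P" "(f [^]\<^bsub>A\<^esub> n \<otimes>\<^bsub>A\<^esub> h n) (\<one>\<^bsub>S\<^esub> \<otimes>\<^bsub>S\<^esub> s)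
      = (f [^]\<^bsub>A\<^esub> n) \<one>\<^bsub>S\<^esub> \<otimes> \<omega> \<one>\<^bsub>S\<^esub> (h n s) \<oplus> p"
    using mult_leading_coeff[OF _ one_pow h v[of n, unfolded vs]] f by auto
  then show ?thesis
    using g[of n] f h sS(1) by (auto simp: power_at_one)
qed

end

section \<open>Rigid coefficients\<close>

locale rigid_skew_power_series = skew_power_series S leq R \<omega>
  for S :: "('s, 'n) monoid_scheme" and leq and R :: "('a, 'm) ring_scheme" (structure)
    and \<omega> +
  assumes rigid: "S_rigid S R \<omega>"
    and acc: "acc_on_annihilators R"
begin

text \<open>For the identity endomorphism rigidity is the absence of nonzero elements of square zero.\<close>

lemma reduced_R: "reduced R"
proof -
  have "rigid_endomorphism R (\<omega> \<one>\<^bsub>S\<^esub>)"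
    using rigid unfolding S_rigid_def by simp
  then show ?thesis
    unfolding reduced_iff_no_square_zero rigid_endomorphism_def
    using omega_at_one by metis
qed

lemma separating_prime_exists:
  assumes "x \<in> carrier R" "x \<noteq> \<zero>"
  obtains c where "c \<in> carrier R" "x \<notin> right_annihilator R {c}"
    "invariant_completely_prime S leq R \<omega> (right_annihilator R {c})"
proof -
  obtain c where c: "c \<in> carrier R" "x \<notin> right_annihilator R {c}"
    and prime: "\<And>a b. \<lbrakk>a \<in> carrier R; b \<in> carrier R; a \<otimes> b \<in> right_annihilator R {c}\<rbrakk>
      \<Longrightarrow> a \<in> right_annihilator R {c} \<or> b \<in> right_annihilator R {c}"
    using completely_prime_annihilator_exists[OF reduced_R acc assms] by blast
  have "invariant_completely_prime_axioms S R \<omega> (right_annihilator R {c})"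
  proof
    show "\<omega> s a \<in> right_annihilator R {c} \<longleftrightarrow> a \<in> right_annihilator R {c}"
      if "s \<in> carrier S" "a \<in> carrier R" for s a
      using that rigid c(1) unfolding S_rigid_def
      by (intro rigid_in_annihilator_iff reduced_R) auto
  qed (rule prime)
  then have "invariant_completely_prime S leq R \<omega> (right_annihilator R {c})"
    using skew_power_series_axioms ideal_annihilator[OF reduced_R c(1)]
    by (intro invariant_completely_prime.intro)
  with c show thesis
    by (rule that)
qed

lemma reduced_A: "reduced A"
  unfolding reduced_def
proof (intro ballI impI)
  fix f
  assume f: "f \<in> carrier A" and "\<exists>n::nat. f [^]\<^bsub>A\<^esub> n = \<zero>\<^bsub>A\<^esub>"
  then obtain n :: nat where n: "f [^]\<^bsub>A\<^esub> n = \<zero>\<^bsub>A\<^esub>" by blast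
  have "f s = \<zero>" if s: "s \<in> carrier S" for s
  proof (rule ccontr)
    assume "f s \<noteq> \<zero>"
    then obtain c where c: "f s \<notin> right_annihilator R {c}"
      and P: "invariant_completely_prime S leq R \<omega> (right_annihilator R {c})"
      using separating_prime_exists[OF coeff_closed[OF f s] \<open>f s \<noteq> \<zero>\<close>] by metis
    interpret P: invariant_completely_prime S leq R \<omega> "right_annihilator R {c}"
      by (rule P)
    obtain t where t: "P.leads f t"
      using P.leads_exists[of s f] s c by blast
    have "t [^]\<^bsub>S\<^esub> n \<in> carrier S" "\<zero>\<^bsub>A\<^esub> (t [^]\<^bsub>S\<^esub> n) \<notin> right_annihilator R {c}"
      using P.leads_power[OF f t, of n] unfolding n P.leads_def by auto
    then show False
      using P.P.zero_closed by simp
  qed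
  then show "f = \<zero>\<^bsub>A\<^esub>"
    using f by (intro series_eqI) auto
qed

text \<open>If \<open>P\<close> is the annihilator of \<open>c\<close>, a congruence modulo \<open>P\<close> becomes an equation after
  multiplication by \<open>c\<close> on the right, which preserves divisibility on the left by powers of
  \<open>f \<one>\<close>.\<close>

lemma right_archimedean_A:
  assumes arch: "right_archimedean R"
  shows "right_archimedean A"
  unfolding right_archimedean_def
proof
  fix f
  assume f: "f \<in> carrier A - Units A"
  then have fA: "f \<in> carrier A" and nonunit: "f \<one>\<^bsub>S\<^esub> \<in> carrier R - Units R"
    using unit_if_unit_at_one by auto
  show "(\<Inter>n::nat. (f [^]\<^bsub>A\<^esub> n) <#\<^bsub>A\<^esub> carrier A) = {\<zero>\<^bsub>A\<^esub>}" (is "?I = _")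
  proof (intro equalityI subsetI)
    fix g
    assume "g \<in> {\<zero>\<^bsub>A\<^esub>}"
    then have "g = f [^]\<^bsub>A\<^esub> n \<otimes>\<^bsub>A\<^esub> \<zero>\<^bsub>A\<^esub>" for n :: nat
      using fA by simp
    then show "g \<in> ?I"
      unfolding l_coset_def by blast
  next
    fix g
    assume "g \<in> ?I"
    then have "\<forall>n::nat. \<exists>h\<in>carrier A. g = f [^]\<^bsub>A\<^esub> n \<otimes>\<^bsub>A\<^esub> h"
      unfolding l_coset_def by blast
    then obtain h where h: "\<And>n::nat. h n \<in> carrier A" and g: "\<And>n. g = f [^]\<^bsub>A\<^esub> n \<otimes>\<^bsub>A\<^esub> h n"
      by metis
    have gA: "g \<in> carrier A"
      using g[of 0] fA h by (metis A.m_closed A.nat_pow_closed)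
    have "g s = \<zero>" if s: "s \<in> carrier S" for s
    proof (rule ccontr)
      assume "g s \<noteq> \<zero>"
      then obtain c where c: "c \<in> carrier R" "g s \<notin> right_annihilator R {c}"
        and P: "invariant_completely_prime S leq R \<omega> (right_annihilator R {c})"
        using separating_prime_exists[OF coeff_closed[OF gA s] \<open>g s \<noteq> \<zero>\<close>] by metis
      interpret P: invariant_completely_prime S leq R \<omega> "right_annihilator R {c}"
        by (rule P)
      obtain t where t: "P.leads g t"
        using P.leads_exists[of s g] s c(2) by blast
      then have gt: "g t \<in> carrier R" "g t \<notin> right_annihilator R {c}"
        using gA unfolding P.leads_def by auto
      have "g t \<otimes> c \<in> f \<one>\<^bsub>S\<^esub> [^] n <# carrier R" for n :: nat
      proof -
        obtain y p where y: "y \<in> carrier R" and p: "p \<in> right_annihilator R {c}"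
          and eq: "g t = f \<one>\<^bsub>S\<^esub> [^] n \<otimes> y \<oplus> p"
          using P.leading_coeff_divisible[OF fA h g t] by blast
        have "p \<in> carrier R" "p \<otimes> c = \<zero>"
          using p zero_product_commute[OF reduced_R, of c p] c(1) by (simp_all add: in_annihilator_iff)
        then have "g t \<otimes> c = f \<one>\<^bsub>S\<^esub> [^] n \<otimes> (y \<otimes> c)"
          unfolding eq using y c(1) nonunit by (simp add: l_distr m_assoc)
        then show ?thesis
          unfolding l_coset_def using y c(1) by blast
      qed
      then have "g t \<otimes> c = \<zero>"
        using arch nonunit unfolding right_archimedean_def by blast
      then show False
        using zero_product_commute[OF reduced_R, of "g t" c] gt c(1) by (simp add: in_annihilator_iff)
    qed
    then show "g \<in> {\<zero>\<^bsub>A\<^esub>}"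
      using series_eqI[of g "\<zero>\<^bsub>A\<^esub>"] gA by simp
  qed
qed

end

theorem theorem3p2:
  fixes S :: "('s, 'n) monoid_scheme"
    and leq :: "'s rel"
    and R :: "('a, 'm) ring_scheme"
    and \<omega> :: "'s \<Rightarrow> 'a \<Rightarrow> 'a"
  assumes "strictly_totally_ordered_monoid S leq"
    and "artinian_on (carrier S) leq"
    and "ring R"
    and "monoid_homomorphism S (End_monoid R) \<omega>"
    and "right_archimedean R"
    and "S_rigid S R \<omega>"
    and "acc_on_annihilators R"
    and "\<forall>s\<in>carrier S. preserves_nonunits R (\<omega> s)"
  shows "ring (skew_gps_ring S leq R \<omega>)
    \<and> right_archimedean (skew_gps_ring S leq R \<omega>)
    \<and> reduced (skew_gps_ring S leq R \<omega>)"
proof -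
  interpret rigid_skew_power_series S leq R \<omega>
    using assms
    by (intro rigid_skew_power_series.intro skew_power_series.intro well_ordered_monoid.intro
        well_ordered_monoid_axioms.intro skew_power_series_axioms.intro
        rigid_skew_power_series_axioms.intro)
  show ?thesis
    using ring_A right_archimedean_A[OF assms(5)] reduced_A by blast
qed

end
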